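(* Let $X$ be a Delone set of finite type in $\mathbb{R}^n$ that is repetitive. If $X$ is an $(r,R)$-set, then for all $T>0$ $$M_X(T)\ge r\left(N_X(T)^{1/n}-1\right).$$
   Context: A Delone set, or $(r,R)$-set, in $\mathbb{R}^n$ is a set $X\subset\mathbb{R}^n$ such that, for the given $r,R>0$, each open ball of radius $r$ contains at most one point of $X$ and each closed ball of radius $R$ contains at least one point of $X$. $X$ is of finite type if $X-X=\{\mathbf{x}-\mathbf{y}:\mathbf{x},\mathbf{y}\in X\}$ meets every bounded set in a finite set. $B(\mathbf{x};T)$ is the closed ball of radius $T$ centered at $\mathbf{x}$. The patch-counting function $N_X(T)$ is the number of distinct sets $(X\cap B(\mathbf{x};T))-\mathbf{x}$, $\mathbf{x}\in X$. $X$ is repetitive if for each $T>0$ there is a finite $M>0$ such that every closed ball of radius $M$ in $\mathbb{R}^n$ contains, for every $\mathbf{y}\in X$, some $\mathbf{x}\in X$ with $(X\cap B(\mathbf{x};T))-\mathbf{x}=(X\cap B(\mathbf{y};T))-\mathbf{y}$; the repetitivity function $M_X(T)$ is the least such $M$. *)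

theory Defs
  imports "HOL-Analysis.Analysis"
begin

definition delone_set :: "real \<Rightarrow> real \<Rightarrow> (real ^ 'n) set \<Rightarrow> bool" where
  "delone_set r R X \<longleftrightarrow> 0 < r \<and> 0 < R \<and>
     (\<forall>c. \<forall>x \<in> X \<inter> ball c r. \<forall>y \<in> X \<inter> ball c r. x = y) \<and>
     (\<forall>c. X \<inter> cball c R \<noteq> {})"

definition finite_type :: "(real ^ 'n) set \<Rightarrow> bool" where
  "finite_type X \<longleftrightarrow> (\<forall>S. bounded S \<longrightarrow> finite ({x - y |x y. x \<in> X \<and> y \<in> X} \<inter> S))"

definition patch :: "(real ^ 'n) set \<Rightarrow> real \<Rightarrow> real ^ 'n \<Rightarrow> (real ^ 'n) set" where
  "patch X T x = (\<lambda>z. z - x) ` (X \<inter> cball x T)"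

definition patch_count :: "(real ^ 'n) set \<Rightarrow> real \<Rightarrow> nat" where
  "patch_count X T = card (patch X T ` X)"

definition repetitivity_radius :: "(real ^ 'n) set \<Rightarrow> real \<Rightarrow> real \<Rightarrow> bool" where
  "repetitivity_radius X T M \<longleftrightarrow> 0 < M \<and>
     (\<forall>c. \<forall>y \<in> X. \<exists>x \<in> X \<inter> cball c M. patch X T x = patch X T y)"

definition repetitive :: "(real ^ 'n) set \<Rightarrow> bool" where
  "repetitive X \<longleftrightarrow> (\<forall>T>0. \<exists>M. repetitivity_radius X T M)"

definition repetitivity :: "(real ^ 'n) set \<Rightarrow> real \<Rightarrow> real" where
  "repetitivity X T = (LEAST M. repetitivity_radius X T M)"

text \<open>The constants \<open>card\<close> and \<open>LEAST\<close> above return unspecified or dummy values on infinite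
  sets and when no least element exists. The following facts show that neither case arises
  for the Delone sets considered here.\<close>

lemma finite_patches:
  fixes X :: "(real ^ 'n) set"
  assumes "finite_type X"
  shows "finite (patch X T ` X)"
proof -
  let ?D = "{x - y |x y. x \<in> X \<and> y \<in> X} \<inter> cball 0 T"
  have "finite ?D"
    using assms by (simp add: finite_type_def)
  moreover have "patch X T ` X \<subseteq> Pow ?D"
    by (auto simp: patch_def dist_norm norm_minus_commute)
  ultimately show ?thesis
    by (meson finite_Pow_iff finite_subset)
qed

lemma finite_type_locally_finite:
  fixes X :: "(real ^ 'n) set"
  assumes "finite_type X" "bounded S"
  shows "finite (X \<inter> S)"
proof (cases "X = {}")
  case False
  then obtain a where a: "a \<in> X" by blast
  have "bounded ((\<lambda>z. z - a) ` S)"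
    using bounded_translation_minus[OF assms(2)] .
  then have "finite ({x - y |x y. x \<in> X \<and> y \<in> X} \<inter> (\<lambda>z. z - a) ` S)"
    using assms(1) by (simp add: finite_type_def)
  then have "finite ((\<lambda>z. z - a) ` (X \<inter> S))"
    by (rule rev_finite_subset) (use a in blast)
  then show ?thesis
    by (rule finite_imageD) (simp add: inj_on_def)
qed simp

lemma repetitivity_radius_repetitivity:
  fixes X :: "(real ^ 'n) set"
  assumes X: "delone_set r R X" "finite_type X" "repetitive X" and T: "0 < T"
  shows "repetitivity_radius X T (repetitivity X T)"
    and "repetitivity_radius X T M \<Longrightarrow> repetitivity X T \<le> M"
proof -
  define S where "S = Collect (repetitivity_radius X T)"
  define m where "m = Inf S"
  have ne: "S \<noteq> {}"
    using X(3) T by (auto simp: repetitive_def S_def)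
  have bdd: "bdd_below S"
    by (auto simp: S_def repetitivity_radius_def intro!: bdd_belowI[of _ 0])
  have m0: "0 \<le> m"
    unfolding m_def by (rule cInf_greatest[OF ne]) (auto simp: S_def repetitivity_radius_def)
  have lower: "m \<le> M" if "repetitivity_radius X T M" for M
    unfolding m_def by (rule cInf_lower[OF _ bdd]) (use that in \<open>simp add: S_def\<close>)
  have attained: "\<exists>x \<in> X \<inter> cball c m. patch X T x = patch X T y" if y: "y \<in> X" for c y
  proof (rule ccontr)
    assume no: "\<not> ?thesis"
    define F where "F = {x \<in> X \<inter> cball c (m + 1). patch X T x = patch X T y}"
    have "finite F"
      by (rule finite_subset[OF _ finite_type_locally_finite[OF X(2) bounded_cball[of c "m + 1"]]])
        (auto simp: F_def)
    define d where "d = Min (insert (m + 1) (dist c ` F))"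
    have "m < d"
      using \<open>finite F\<close> no by (auto simp: d_def F_def not_le)
    then obtain M where M: "M \<in> S" "M < d"
      using cInf_lessD[OF ne] by (auto simp: m_def)
    then obtain x where x: "x \<in> X \<inter> cball c M" "patch X T x = patch X T y"
      using y unfolding S_def repetitivity_radius_def mem_Collect_eq
      by blast
    have "d \<le> m + 1"
      using \<open>finite F\<close> by (simp add: d_def)
    then have "x \<in> F"
      using x M by (simp add: F_def)
    then have "d \<le> dist c x"
      using \<open>finite F\<close> by (simp add: d_def)
    then show False
      using x M by simp
  qed
  have "m \<noteq> 0"
  proof
    assume "m = 0"
    obtain y where "y \<in> X"
      using X(1) unfolding delone_set_def by blast
    then have all: "c \<in> X" for c
      using attained[of y c] \<open>m = 0\<close> by auto
    have r: "0 < r"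
      using X(1) by (simp add: delone_set_def)
    obtain v :: "real ^ 'n" where v: "norm v = r / 2"
      using vector_choose_size[of "r / 2"] r by auto
    then have "v \<in> ball 0 r" "0 \<in> ball (0 :: real ^ 'n) r"
      using r by auto
    then have "v = 0"
      using X(1) all unfolding delone_set_def by blast
    then show False
      using v r by simp
  qed
  then have m: "repetitivity_radius X T m"
    using m0 attained by (simp add: repetitivity_radius_def)
  then have eq: "repetitivity X T = m"
    unfolding repetitivity_def by (rule Least_equality) (rule lower)
  show "repetitivity_radius X T (repetitivity X T)"
    using m eq by simp
  show "repetitivity_radius X T M \<Longrightarrow> repetitivity X T \<le> M"
    using lower eq by simp
qed

end

theory Submission
  imports Defs
begin

text \<open>A closed ball of radius \<open>M = M_X(T)\<close> contains a centre of each of the \<open>N = N_X(T)\<close> patches,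
  and distinct patches have distinct centres. The open balls of radius \<open>r\<close> about these centres
  are disjoint, since a common point \<open>z\<close> would put two points of \<open>X\<close> into the open ball of
  radius \<open>r\<close> about \<open>z\<close>. They lie in a ball of radius \<open>M + r\<close>, and comparing volumes gives
  \<open>N r^n \<le> (M + r)^n\<close>.\<close>

lemma packing_bound:
  fixes P :: "'a::euclidean_space set"
  assumes P: "finite P" "P \<subseteq> cball c M" and pos: "0 \<le> M" "0 < r"
    and disj: "disjoint_family_on (\<lambda>x. ball x r) P"
  shows "real (card P) * r ^ DIM('a) \<le> (M + r) ^ DIM('a)"
proof -
  let ?v = "unit_ball_vol (real DIM('a))"
  have "real (card P) * (?v * r ^ DIM('a)) = (\<Sum>x\<in>P. measure lborel (ball x r))"
    using pos by (simp add: content_ball)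
  \<comment> \<open>\<open>measure\<close> sends infinite volume to 0, so additivity here, and
    monotonicity in the next step, rest on balls having finite volume.\<close>
  also have "\<dots> = measure lborel (\<Union>x\<in>P. ball x r)"
    using P(1) disj
    by (intro measure_finite_Union[symmetric])
      (use emeasure_lborel_ball_finite[THEN less_imp_neq] in \<open>auto simp: image_subset_iff\<close>)
  also have "\<dots> \<le> measure lborel (cball c (M + r))"
  proof (rule measure_mono_fmeasurable)
    show "(\<Union>x\<in>P. ball x r) \<subseteq> cball c (M + r)"
    proof clarsimp
      fix x y assume "x \<in> P" "dist x y < r"
      then show "dist c y \<le> M + r"
        using P(2) dist_triangle[of c y x] by force
    qed
  qed (auto intro!: borel_open fmeasurableI emeasure_lborel_cball_finite)
  also have "\<dots> = ?v * (M + r) ^ DIM('a)"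
    using pos by (simp add: content_cball)
  finally have "?v * (real (card P) * r ^ DIM('a)) \<le> ?v * (M + r) ^ DIM('a)"
    by (simp add: mult_ac)
  then show ?thesis
    by (rule mult_left_le_imp_le) (simp add: unit_ball_vol_pos)
qed

lemma delone_set_disjoint_balls:
  assumes "delone_set r R X"
  shows "disjoint_family_on (\<lambda>x. ball x r) X"
  unfolding disjoint_family_on_def
proof (intro ballI impI, rule ccontr)
  fix x y assume xy: "x \<in> X" "y \<in> X" "x \<noteq> y" and "ball x r \<inter> ball y r \<noteq> {}"
  then obtain z where "x \<in> ball z r" "y \<in> ball z r"
    by (auto simp: dist_commute)
  then show False
    using assms xy unfolding delone_set_def by blast
qed

text \<open>The ball may contain several centres of the same patch; keeping one for each makes
  \<open>P\<close> equinumerous with the patches and lets it inherit their finiteness.\<close>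

lemma repetitivity_radius_patch_representatives:
  assumes "repetitivity_radius X T M"
  obtains P where "P \<subseteq> X \<inter> cball c M" "bij_betw (patch X T) P (patch X T ` X)"
proof -
  have "patch X T ` X = patch X T ` (X \<inter> cball c M)"
  proof (intro equalityI subsetI)
    fix p assume "p \<in> patch X T ` X"
    then obtain y where "y \<in> X" "p = patch X T y" by blast
    then obtain x where "x \<in> X \<inter> cball c M" "patch X T x = p"
      using assms unfolding repetitivity_radius_def by metis
    then show "p \<in> patch X T ` (X \<inter> cball c M)" by blast
  qed blast
  then show ?thesis
    using subset_image_inj[of "patch X T ` X" "patch X T" "X \<inter> cball c M"] that
    by (auto simp: bij_betw_def)
qed

theorem theorem4p1:
  fixes X :: "(real ^ 'n) set" and r R T :: real
  assumes "delone_set r R X"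
    and "finite_type X"
    and "repetitive X"
    and "0 < T"
  shows "repetitivity X T \<ge> r * (real (patch_count X T) powr (1 / real CARD('n)) - 1)"
proof -
  define M where "M = repetitivity X T"
  define N where "N = patch_count X T"
  \<comment> \<open>The least radius is attained, so the packing argument applies to
    \<open>M\<close> itself and not only to larger radii.\<close>
  have rad: "repetitivity_radius X T M"
    unfolding M_def by (rule repetitivity_radius_repetitivity[OF assms])
  then have M: "0 < M" by (simp add: repetitivity_radius_def)
  have r: "0 < r" using assms(1) by (simp add: delone_set_def)
  \<comment> \<open>Every centre serves equally well; the origin is an arbitrary choice.\<close>
  obtain P where P: "P \<subseteq> X \<inter> cball 0 M" and bij: "bij_betw (patch X T) P (patch X T ` X)"
    using repetitivity_radius_patch_representatives[OF rad] .
  have "finite P"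
    using bij_betw_finite[OF bij] finite_patches[OF assms(2)] by simp
  moreover have "disjoint_family_on (\<lambda>x. ball x r) P"
    using P by (intro disjoint_family_on_mono[OF _ delone_set_disjoint_balls[OF assms(1)]]) auto
  ultimately have "real (card P) * r ^ CARD('n) \<le> (M + r) ^ CARD('n)"
    using packing_bound[of P 0 M r] P M r by simp
  moreover have "card P = N"
    using bij_betw_same_card[OF bij] by (simp add: N_def patch_count_def)
  ultimately have "real N \<le> ((M + r) / r) ^ CARD('n)"
    using r by (simp add: power_divide field_simps)
  then have "real N powr (1 / real CARD('n))
      \<le> (((M + r) / r) ^ CARD('n)) powr (1 / real CARD('n))"
    by (intro powr_mono2) auto
  \<comment> \<open>The base is positive, so its natural power can be rewritten with
    \<open>powr\<close>, and the exponents multiply to 1.\<close>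
  also have "\<dots> = (M + r) / r"
    using M r by (simp add: powr_realpow[symmetric] powr_powr)
  finally show ?thesis
    using r by (simp add: M_def N_def field_simps)
qed

end
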